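(* With \begin{align*} d_3^+&=0.854187179928304211983581540152668, & d_3^-&=-0.708415898743967960305146324178773,\\ d_4^+&=1.5834687793247475, & d_4^-&=-1.5060895457389591, \end{align*} we have \begin{align*} d_3^+-3\cdot10^{-33}&\le \sup_n\delta_3(n)\le d_3^+, & d_3^-&\le\inf_n\delta_3(n)\le d_3^-+3\cdot10^{-33},\\ d_4^+-6\cdot10^{-16}&\le \sup_n\delta_4(n)\le d_4^+, & d_4^-&\le\inf_n\delta_4(n)\le d_4^-+6\cdot10^{-16}. \end{align*} Consequently $\sup_n|\delta_3(n)|=\sup_n\delta_3(n)$ and $\sup_n|\delta_4(n)|=\sup_n\delta_4(n)$, and these satisfy the same bounds as $\sup_n\delta_3(n)$ and $\sup_n\delta_4(n)$ respectively.
   Context: For $k\ge1$, $F_k:\mathbb{N}\to\mathbb{N}$ is defined by $F_k(0)=0$ and $F_k(n)=n-F_k^k(n-1)$ for $n\ge1$, where $F_k^k$ is the $k$-fold iterate of $F_k$. $\alpha_k$ is the unique positive real zero of $X^k+X-1$, and $\delta_k(n)=F_k(n)-\alpha_k n$; suprema and infima are over $n\in\mathbb{N}$. *)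

theory Defs
  imports "HOL-Analysis.Analysis"
begin

section \<open>The functions \<open>F\<^sub>k\<close>\<close>

text \<open>
  The recursion \<open>F\<^sub>k(n) = n - F\<^sub>k\<^sup>k(n-1)\<close> is nested, so \<open>F\<^sub>k\<close> is introduced as the only
  function satisfying it. Truncated subtraction on \<^typ>\<open>nat\<close> makes the equation total;
  \<open>F_funpow_le\<close> below shows that no truncation ever occurs.
\<close>

definition F_spec :: "nat \<Rightarrow> (nat \<Rightarrow> nat) \<Rightarrow> bool" where
  "F_spec k f \<longleftrightarrow> f 0 = 0 \<and> (\<forall>n\<ge>1. f n = n - (f ^^ k) (n - 1))"

definition F :: "nat \<Rightarrow> nat \<Rightarrow> nat" where
  "F k = (THE f. F_spec k f)"

lemma funpow_le_self:
  fixes f :: "nat \<Rightarrow> nat"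
  assumes "\<And>m. f m \<le> m"
  shows "(f ^^ j) m \<le> m"
  by (induction j) (auto intro: order_trans assms)

lemma funpow_eq_below:
  fixes f g :: "nat \<Rightarrow> nat"
  assumes "\<And>m. f m \<le> m" and "\<And>m. m \<le> n \<Longrightarrow> f m = g m"
  shows "m \<le> n \<Longrightarrow> (f ^^ j) m = (g ^^ j) m"
proof (induction j)
  case (Suc j)
  have "(f ^^ j) m \<le> n"
    using funpow_le_self[of f j m] assms(1) Suc.prems by (meson order_trans)
  then show ?case
    using Suc assms(2) by simp
qed simp

text \<open>\<open>F_table k n\<close> has the values of \<open>F\<^sub>k\<close> up to \<open>n\<close> and is \<open>0\<close> afterwards.\<close>

primrec F_table :: "nat \<Rightarrow> nat \<Rightarrow> nat \<Rightarrow> nat" where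
  "F_table k 0 = (\<lambda>_. 0)"
| "F_table k (Suc n) = (F_table k n)(Suc n := Suc n - (F_table k n ^^ k) n)"

lemma F_table_le: "F_table k n m \<le> m"
  by (induction n) auto

lemma F_table_stable: "m \<le> n \<Longrightarrow> F_table k n m = F_table k m m"
  by (induction n) (auto simp: le_Suc_eq)

lemma F_spec_le:
  assumes "F_spec k f"
  shows "f m \<le> m"
  using assms unfolding F_spec_def
  by (metis diff_le_self le_0_eq less_one linorder_not_less)

lemma F_spec_ex1: "\<exists>!f. F_spec k f"
proof (rule ex_ex1I)
  define f where "f = (\<lambda>n. F_table k n n)"
  have "f n = n - (f ^^ k) (n - 1)" if n: "n \<ge> 1" for n
  proof -
    obtain p where p: "n = Suc p"
      using n by (cases n) auto
    have "(F_table k p ^^ k) p = (f ^^ k) p"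
      by (rule funpow_eq_below[where n = p]) (simp_all add: F_table_le f_def F_table_stable[of _ p])
    then show ?thesis
      by (simp add: f_def p)
  qed
  moreover have "f 0 = 0"
    by (simp add: f_def)
  ultimately show "\<exists>f. F_spec k f"
    unfolding F_spec_def by blast
next
  fix f g
  assume f: "F_spec k f" and g: "F_spec k g"
  have "\<forall>m\<le>n. f m = g m" for n
  proof (induction n)
    case 0
    then show ?case
      using f g by (simp add: F_spec_def)
  next
    case (Suc n)
    have "(f ^^ k) n = (g ^^ k) n"
      by (rule funpow_eq_below[where n = n]) (use F_spec_le[OF f] Suc in auto)
    then have "f (Suc n) = g (Suc n)"
      using f g by (simp add: F_spec_def)
    then show ?case
      using Suc by (auto simp: le_Suc_eq)
  qed
  then show "f = g"
    by blast
qed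

lemma F_spec_F: "F_spec k (F k)"
  unfolding F_def by (rule theI'[OF F_spec_ex1])

lemma F_0: "F k 0 = 0"
  using F_spec_F by (simp add: F_spec_def)

lemma F_rec: "n \<ge> 1 \<Longrightarrow> F k n = n - (F k ^^ k) (n - 1)"
  using F_spec_F by (simp add: F_spec_def)

lemma F_funpow_le: "(F k ^^ j) n \<le> n"
  by (rule funpow_le_self) (rule F_spec_le[OF F_spec_F])

section \<open>The root \<open>\<alpha>\<^sub>k\<close> and the discrepancy \<open>\<delta>\<^sub>k\<close>\<close>

definition alpha :: "nat \<Rightarrow> real" where
  "alpha k = (THE x. 0 < x \<and> x ^ k + x - 1 = 0)"

lemma alpha_ex1:
  assumes "k \<ge> 1"
  shows "\<exists>!x::real. 0 < x \<and> x ^ k + x - 1 = 0"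
proof (rule ex_ex1I)
  have "\<exists>x\<ge>0. x \<le> 1 \<and> x ^ k + x - 1 = (0::real)"
    by (rule IVT') (use assms in \<open>auto simp: power_0_left intro!: continuous_intros\<close>)
  then obtain x :: real where x: "0 \<le> x" "x ^ k + x - 1 = 0"
    by blast
  moreover have "x \<noteq> 0"
    using x(2) assms by (auto simp: power_0_left)
  ultimately show "\<exists>x::real. 0 < x \<and> x ^ k + x - 1 = 0"
    by (intro exI[of _ x]) auto
next
  fix x y :: real
  assume x: "0 < x \<and> x ^ k + x - 1 = 0" and y: "0 < y \<and> y ^ k + y - 1 = 0"
  have "x ^ k \<le> y ^ k" if "x < y"
    using x that by (intro power_mono) auto
  moreover have "y ^ k \<le> x ^ k" if "y < x"
    using y that by (intro power_mono) auto
  ultimately show "x = y"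
    using x y by (cases x y rule: linorder_cases) auto
qed

definition delta :: "nat \<Rightarrow> nat \<Rightarrow> real" where
  "delta k n = real (F k n) - alpha k * real n"

text \<open>
  Suprema and infima are taken in \<^typ>\<open>ereal\<close>, where they always exist, so that the upper bounds
  on the suprema and the lower bounds on the infima include the boundedness of \<open>\<delta>\<^sub>k\<close>.
\<close>

definition sup_delta :: "nat \<Rightarrow> ereal" where
  "sup_delta k = (SUP n. ereal (delta k n))"

definition inf_delta :: "nat \<Rightarrow> ereal" where
  "inf_delta k = (INF n. ereal (delta k n))"

definition sup_abs_delta :: "nat \<Rightarrow> ereal" where
  "sup_abs_delta k = (SUP n. ereal \<bar>delta k n\<bar>)"

section \<open>Numerical constants\<close>

definition d3_plus :: real where
  "d3_plus = 0.854187179928304211983581540152668"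

definition d3_minus :: real where
  "d3_minus = - 0.708415898743967960305146324178773"

definition d4_plus :: real where
  "d4_plus = 1.5834687793247475"

definition d4_minus :: real where
  "d4_minus = - 1.5060895457389591"

end

theory Submission
  imports Defs
begin

text \<open>
  Let \<open>A\<^sub>0 = 1\<close>, \<open>A\<^sub>n\<^sub>+\<^sub>1 = A\<^sub>n + A\<^sub>n\<^sub>+\<^sub>1\<^sub>-\<^sub>k\<close>. Since \<open>F\<^sub>k (A\<^sub>m + r) = A\<^sub>m\<^sub>-\<^sub>1 + F\<^sub>k r\<close> for
  \<open>r \<le> A\<^sub>m\<^sub>+\<^sub>1\<^sub>-\<^sub>k\<close>, the discrepancy is additive along the greedy expansion of \<open>n\<close> in the \<open>A\<^sub>m\<close>, whose
  indices are at least \<open>k\<close> apart. The maximum of \<open>\<delta>\<^sub>k\<close> below \<open>A\<^sub>N\<close> is thus that of a weighted selection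
  problem, which a linear recursion solves. It is run in exact integer arithmetic after scaling by
  \<open>10\<^sup>1\<^sup>1\<^sup>0\<close> and replacing \<open>\<alpha>\<^sub>k\<close> by a decimal truncation. The indices beyond \<open>N\<close> contribute at most
  the sum of the \<open>\<bar>\<delta>\<^sub>k(A\<^sub>i)\<bar>\<close>, \<open>i \<ge> N\<close>. Eliminating the root \<open>1/\<alpha>\<^sub>k\<close> from the recursion shows that
  these decay geometrically, so twice the sum of a first block bounds them all.
\<close>

section \<open>Numeration\<close>

text \<open>Here and below \<open>g\<close> stands for \<open>k - 1\<close>. Negative indices are truncated to \<open>0\<close>.\<close>

fun A :: "nat \<Rightarrow> nat \<Rightarrow> nat" where
  "A g 0 = 1"
| "A g (Suc n) = A g n + A g (n - g)"

lemma A_pos: "0 < A g n"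
  by (induction g n rule: A.induct) auto

lemma mono_A: "mono (A g)"
  by (rule incseq_SucI) simp

lemma A_gt: "n < A g n"
proof (induction n)
  case (Suc n)
  then show ?case
    using A_pos[of g "n - g"] by simp
qed simp

lemma A_small: "n \<le> Suc g \<Longrightarrow> A g n = Suc n"
  by (induction n) auto

text \<open>By \<open>F_rec\<close>, a step of \<open>F k\<close> is one minus a step of
  \<open>F k ^^ k\<close> at a smaller argument, and iterates of a map with steps 0 or 1 again have
  steps 0 or 1.\<close>

lemma F_step: "F k n \<le> F k (Suc n) \<and> F k (Suc n) \<le> Suc (F k n)"
proof (induction n rule: less_induct)
  case (less n)
  show ?case
  proof (cases n)
    case 0
    then show ?thesis
      by (simp add: F_0 F_rec)
  next
    case (Suc q)
    have *: "(F k ^^ j) q \<le> (F k ^^ j) n \<and> (F k ^^ j) n \<le> Suc ((F k ^^ j) q)" for j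
    proof (induction j)
      case 0
      then show ?case
        using Suc by simp
    next
      case (Suc j)
      let ?x = "(F k ^^ j) q"
      have "?x < n"
        using F_funpow_le[of j k q] \<open>n = Suc q\<close> by simp
      moreover have "(F k ^^ j) n = ?x \<or> (F k ^^ j) n = Suc ?x"
        using Suc by linarith
      ultimately show ?case
        using less.IH by auto
    qed
    have "(F k ^^ k) q \<le> q"
      by (rule F_funpow_le)
    then show ?thesis
      using *[of k] F_rec[of n k] F_rec[of "Suc n" k] Suc by auto
  qed
qed

lemma mono_F: "mono (F k)"
  by (rule incseq_SucI) (simp add: F_step)

text \<open>Each application lowers the argument by one until the fixed point 1 is reached, and
  \<open>Suc g\<close> applications from \<open>n - 1 \<le> g + 2\<close> always get there.\<close>

lemma F_small:
  assumes "1 \<le> n" "n \<le> g + 3"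
  shows "F (Suc g) n = max 1 (n - 1)"
  using assms
proof (induction n rule: less_induct)
  case (less n)
  have *: "(F (Suc g) ^^ j) i = max 1 (i - j)" if "1 \<le> i" "i < n" for i j
  proof (induction j)
    case 0
    then show ?case
      using that by simp
  next
    case (Suc j)
    have "max 1 (i - j) < n" "1 \<le> max 1 (i - j)"
      using that by auto
    then have "F (Suc g) (max 1 (i - j)) = max 1 (max 1 (i - j) - 1)"
      using less.IH less.prems by simp
    moreover have "max 1 (max 1 (i - j) - 1) = max 1 (i - Suc j)"
      by arith
    ultimately show ?case
      using Suc by (simp only: funpow.simps o_apply)
  qed
  show ?case
  proof (cases "n = 1")
    case True
    have "(F (Suc g) ^^ j) 0 = 0" for j
      by (induction j) (auto simp: F_0)
    then show ?thesis
      using True F_rec[of 1 "Suc g"] by (simp del: funpow.simps)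
  next
    case False
    then have "(F (Suc g) ^^ Suc g) (n - 1) = 1"
      using *[of "n - 1" "Suc g"] less.prems by simp
    then show ?thesis
      using F_rec[of n "Suc g"] less.prems False by (simp del: funpow.simps)
  qed
qed

text \<open>Iterating the induction hypothesis lowers the index by one per step, so
  \<open>F_rec\<close> reduces the claim to the recursion of \<open>A\<close>. The bound on
  \<open>r\<close> is inclusive because monotonicity of \<open>F\<close> preserves only a weak
  bound. For \<open>m = 0\<close>, \<open>r = 1\<close> the equation is false.\<close>

lemma F_A_add:
  assumes g: "1 \<le> g" and m: "0 < m \<or> r = 0" and r: "r \<le> A g (m - g)"
  shows "F (Suc g) (A g m + r) = A g (m - 1) + F (Suc g) r"
  using m r
proof (induction "A g m + r" arbitrary: m r rule: less_induct)
  case less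
  define f where "f = F (Suc g)"
  note monoA = monoD[OF mono_A[of g]]
  have IH: "f (A g i + s) = A g (i - 1) + f s"
    if "A g i + s < A g m + r" "0 < i \<or> s = 0" "s \<le> A g (i - g)" for i s
    unfolding f_def by (rule less.hyps[OF that])
  have f0: "f 0 = 0"
    by (simp add: f_def F_0)
  have fle: "(f ^^ j) x \<le> x" for j x
    unfolding f_def by (rule F_funpow_le)
  have rec: "f x = x - (f ^^ Suc g) (x - 1)" if "1 \<le> x" for x
    unfolding f_def using that by (rule F_rec)
  have chain: "(f ^^ j) (A g i + s) = A g (i - j) + (f ^^ j) s \<and> (f ^^ j) s \<le> A g (i - j - g)"
    if i: "Suc g \<le> i" and s: "s \<le> A g (i - g)" and lt: "A g i + s < A g m + r" and "j \<le> Suc g"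
    for i s j
    using \<open>j \<le> Suc g\<close>
  proof (induction j)
    case 0
    then show ?case
      using s by simp
  next
    case (Suc j)
    let ?x = "(f ^^ j) s"
    have hyp: "(f ^^ j) (A g i + s) = A g (i - j) + ?x" "?x \<le> A g (i - j - g)"
      using Suc by auto
    have "A g (i - j) \<le> A g i" "A g (i - j - g) \<le> A g i"
      by (auto intro!: monoA)
    then have lt': "A g (i - j) + ?x < A g m + r" "A g (i - j - g) + 0 < A g m + r"
      using lt fle[of j s] by linarith+
    have "f (A g (i - j) + ?x) = A g (i - j - 1) + f ?x"
      using lt' hyp(2) i Suc.prems by (intro IH) auto
    moreover have "f ?x \<le> f (A g (i - j - g))"
      unfolding f_def by (rule monoD[OF mono_F]) (use hyp f_def in simp)
    moreover have "f (A g (i - j - g) + 0) = A g (i - j - g - 1) + f 0"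
      by (rule IH) (use lt' in auto)
    ultimately show ?case
      using hyp(1) f0 by (simp add: diff_commute)
  qed
  have "f (A g m + r) = A g (m - 1) + f r"
  \<comment> \<open>Too small for \<open>chain\<close>, but then
    \<open>A g m + r \<le> g + 2\<close>, which \<open>F_small\<close> covers.\<close>
  proof (cases "m \<le> g \<or> (m = Suc g \<and> r = 0)")
    case True
    then have "r \<le> 1"
      using less.prems by auto
    then consider "r = 0" | "r = 1"
      by linarith
    then show ?thesis
    proof cases
      case 1
      then show ?thesis
        using True f0 g by (auto simp: A_small f_def F_small)
    next
      case 2
      then have "0 < m" "m \<le> g"
        using less.prems True by auto
      then show ?thesis
        using 2 by (simp add: A_small f_def F_small)
    qed
  next
    case False
    then have m: "Suc g \<le> m"
      by simp
    then obtain q where q: "m = Suc q" "g \<le> q"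
      by (cases m) auto
    show ?thesis
    proof (cases "r = 0")
      case False
      have "r \<le> A g (m - g)"
        using less.prems by simp
      then have "(f ^^ Suc g) (A g m + (r - 1)) = A g (m - Suc g) + (f ^^ Suc g) (r - 1)"
        using chain[of m "r - 1" "Suc g"] m False by (auto simp del: funpow.simps)
      moreover have "(f ^^ Suc g) (r - 1) \<le> r - 1"
        by (rule fle)
      moreover have "f (A g m + r) = A g m + r - (f ^^ Suc g) (A g m + (r - 1))"
        "f r = r - (f ^^ Suc g) (r - 1)"
        using rec[of "A g m + r"] rec[of r] False by (simp_all del: funpow.simps)
      moreover have "A g m = A g (m - 1) + A g (m - Suc g)"
        using q by simp
      ultimately show ?thesis
        using False by linarith
    next
      case True
      then have "Suc g \<le> q"
        using False q by simp
      \<comment> \<open>The predecessor of \<open>A g m\<close> is \<open>A g q + (?t - 1)\<close>;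
        \<open>F_rec\<close> at \<open>?t\<close> evaluates the iterate at
        \<open>?t - 1\<close>.\<close>
      let ?t = "A g (q - g)"
      have t: "1 \<le> ?t"
        using A_pos[of g "q - g"] by simp
      have lt: "A g q + (?t - 1) < A g m + r"
        using q t by simp
      have "(f ^^ Suc g) (A g q + (?t - 1)) = A g (q - Suc g) + (f ^^ Suc g) (?t - 1)"
        using chain[of q "?t - 1" "Suc g"] lt \<open>Suc g \<le> q\<close> by (auto simp del: funpow.simps)
      moreover have "?t \<le> A g q"
        by (rule monoA) simp
      then have "f (?t + 0) = A g (q - g - 1) + f 0"
        using q t True by (intro IH) auto
      then have "?t - (f ^^ Suc g) (?t - 1) = A g (q - Suc g)"
        using rec[OF t] f0 by (simp del: funpow.simps)
      moreover have "(f ^^ Suc g) (?t - 1) \<le> ?t - 1"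
        by (rule fle)
      ultimately have "(f ^^ Suc g) (A g q + (?t - 1)) = ?t"
        using t by linarith
      then show ?thesis
        using rec[of "A g m"] True q t f0 by (simp del: funpow.simps)
    qed
  qed
  then show ?case
    by (simp add: f_def)
qed

section \<open>Extremal values of additive functions\<close>

text \<open>The maximal sum of \<open>w\<close> over subsets of \<open>{..<e}\<close> whose elements are more than \<open>g\<close> apart.\<close>

fun top_sum :: "nat \<Rightarrow> (nat \<Rightarrow> 'a::linordered_idom) \<Rightarrow> nat \<Rightarrow> 'a" where
  "top_sum g w 0 = 0"
| "top_sum g w (Suc e) = max (top_sum g w e) (top_sum g w (e - g) + w e)"

lemma mono_top_sum: "mono (top_sum g w)"
  by (rule incseq_SucI) simp

lemma less_A_Suc_cases:
  assumes "x < A g (Suc e)"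
  obtains "x < A g e" | r where "x = A g e + r" "r < A g (e - g)"
proof (cases "x < A g e")
  case False
  then have "x = A g e + (x - A g e)" "x - A g e < A g (e - g)"
    using assms by auto
  then show ?thesis
    using that(2) by blast
qed (use that in blast)

text \<open>A remainder below \<open>A g (e - g)\<close> uses only indices below
  \<open>e - g\<close>, as in the greedy expansion.\<close>

definition block_additive :: "nat \<Rightarrow> (nat \<Rightarrow> 'a::linordered_idom) \<Rightarrow> bool" where
  "block_additive g L \<longleftrightarrow> L 0 = 0 \<and> (\<forall>e r. r < A g (e - g) \<longrightarrow> L (A g e + r) = L (A g e) + L r)"

lemma top_sum_upper:
  assumes L: "block_additive g L"
  shows "x < A g e \<Longrightarrow> L x \<le> top_sum g (\<lambda>i. L (A g i)) e"
proof (induction e arbitrary: x rule: less_induct)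
  case (less e)
  show ?case
  proof (cases e)
    case 0
    then show ?thesis
      using less.prems L by (simp add: block_additive_def)
  next
    case (Suc n)
    have "x < A g (Suc n)"
      using less.prems Suc by simp
    then show ?thesis
    proof (cases rule: less_A_Suc_cases)
      case 1
      then show ?thesis
        using less.IH[of n x] Suc by (simp add: le_max_iff_disj)
    next
      case (2 r)
      then show ?thesis
        using less.IH[of "n - g" r] Suc L by (simp add: block_additive_def le_max_iff_disj)
    qed
  qed
qed

text \<open>Follow the branch of the recursion that realises the maximum; a witness below
  \<open>A g (n - g)\<close> leaves room for adding \<open>A g n\<close>.\<close>

lemma top_sum_attained:
  assumes L: "block_additive g L"
  shows "\<exists>x < A g e. L x = top_sum g (\<lambda>i. L (A g i)) e"
proof (induction e rule: less_induct)
  case (less e)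
  show ?case
  proof (cases e)
    case 0
    then show ?thesis
      using L by (simp add: block_additive_def)
  next
    case (Suc n)
    have "n < e" "n - g < e"
      using Suc by auto
    obtain x where x: "x < A g n" "L x = top_sum g (\<lambda>i. L (A g i)) n"
      using less.IH[of n] \<open>n < e\<close> by blast
    obtain y where y: "y < A g (n - g)" "L y = top_sum g (\<lambda>i. L (A g i)) (n - g)"
      using less.IH[of "n - g"] \<open>n - g < e\<close> by blast
    show ?thesis
    proof (cases "top_sum g (\<lambda>i. L (A g i)) n \<ge> top_sum g (\<lambda>i. L (A g i)) (n - g) + L (A g n)")
      case True
      then show ?thesis
        using x Suc by (intro exI[of _ x]) auto
    next
      case False
      then show ?thesis
        using y Suc L by (intro exI[of _ "A g n + y"]) (auto simp: block_additive_def)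
    qed
  qed
qed

lemma top_sum_tail:
  fixes w :: "nat \<Rightarrow> 'a::linordered_idom"
  shows "top_sum g w (N + j) \<le> top_sum g w N + (\<Sum>i<j. \<bar>w (N + i)\<bar>)"
proof (induction j)
  case (Suc j)
  \<comment> \<open>Monotonicity discards the gap condition, so each further index costs at most its
    absolute weight.\<close>
  have "top_sum g w (N + j - g) \<le> top_sum g w (N + j)"
    by (rule monoD[OF mono_top_sum]) simp
  then show ?case
    using Suc abs_ge_self[of "w (N + j)"] by (simp add: max_def; linarith)
qed simp

text \<open>Summing the hypothesis bounds all terms after the first block by half of the total
  \<open>?T\<close>, which is then absorbed. \<open>?T\<close> has \<open>j + m\<close> terms so
  that it contains every shifted sum.\<close>

lemma contraction_sum_le:
  fixes y :: "nat \<Rightarrow> real"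
  assumes y: "\<And>i. 0 \<le> y i"
    and le: "\<And>i. y (i + m) \<le> a * y i + b * y (i + 1) + c * y (i + 2)"
    and abc: "0 \<le> a" "0 \<le> b" "0 \<le> c" "a + b + c \<le> 1 / 2" and m: "2 \<le> m"
  shows "(\<Sum>i<j. y i) \<le> 2 * (\<Sum>i<m. y i)"
proof -
  let ?T = "\<Sum>i<j + m. y i"
  have shift: "(\<Sum>i<j. y (i + d)) \<le> ?T" if "d \<le> m" for d
  proof -
    have "(\<Sum>i<j. y (i + d)) = sum y ((\<lambda>i. i + d) ` {..<j})"
      by (subst sum.reindex) (auto simp: o_def)
    also have "\<dots> \<le> ?T"
      using that by (intro sum_mono2) (auto simp: y)
    finally show ?thesis .
  qed
  have split: "(\<Sum>i<n + m. y i) = (\<Sum>i<m. y i) + (\<Sum>i<n. y (i + m))" for n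
    by (induction n) auto
  have "(\<Sum>i<j. y (i + m)) \<le> (\<Sum>i<j. a * y i + b * y (i + 1) + c * y (i + 2))"
    by (rule sum_mono) (rule le)
  also have "\<dots> = a * (\<Sum>i<j. y (i + 0)) + b * (\<Sum>i<j. y (i + 1)) + c * (\<Sum>i<j. y (i + 2))"
    by (simp add: sum.distrib sum_distrib_left)
  also have "\<dots> \<le> a * ?T + b * ?T + c * ?T"
    using m abc by (intro add_mono mult_left_mono shift) auto
  also have "\<dots> = (a + b + c) * ?T"
    by (simp add: algebra_simps)
  also have "\<dots> \<le> 1 / 2 * ?T"
    using abc by (intro mult_right_mono sum_nonneg) (auto simp: y)
  finally have "?T \<le> 2 * (\<Sum>i<m. y i)"
    using split[of j] by simp
  then show ?thesis
    using shift[of 0] by simp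
qed

section \<open>The integer computation\<close>

text \<open>A window of \<open>g + 1\<close> values, newest first, padded with \<open>f 0\<close>.
  Its head and last entry are all that a recursion with lag \<open>g\<close> needs.\<close>

definition hist :: "nat \<Rightarrow> (nat \<Rightarrow> 'a) \<Rightarrow> nat \<Rightarrow> 'a list" where
  "hist g f e = map (\<lambda>i. f (e - i)) [0..<Suc g]"

lemma hd_hist: "hd (hist g f e) = f e"
  by (simp add: hist_def hd_map del: upt_Suc)

lemma last_hist: "last (hist g f e) = f (e - g)"
  by (simp add: hist_def)

lemma hist_Suc: "f (Suc e) # butlast (hist g f e) = hist g f (Suc e)"
proof -
  have "hist g f (Suc e) = f (Suc e) # map (\<lambda>i. f (Suc e - i)) (map Suc [0..<g])"
    unfolding hist_def by (subst upt_conv_Cons) (simp_all add: map_Suc_upt del: upt_Suc)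
  then show ?thesis
    by (simp add: hist_def o_def)
qed

lemma hist_1: "hist g f 1 = f 1 # replicate g (f 0)"
proof -
  have "butlast (hist g f 0) = replicate g (f 0)"
    by (simp add: hist_def map_replicate_const butlast_conv_take take_replicate
        del: upt_Suc replicate_Suc)
  then show ?thesis
    using hist_Suc[of f 0 g] by simp
qed

definition push_add :: "int list \<Rightarrow> int list" where
  "push_add xs = (hd xs + last xs) # butlast xs"

definition push_max :: "int \<Rightarrow> int list \<Rightarrow> int list" where
  "push_max w xs = max (hd xs) (last xs + w) # butlast xs"

text \<open>Windows of \<open>A\<close>, of the integer weights, and of \<open>top_sum\<close> for
  the weights and for their negatives.\<close>

type_synonym state = "int list \<times> int list \<times> int list \<times> int list"

text \<open>
  Pattern matching on the state, here and in \<open>verdict\<close>, keeps \<open>code_simp\<close> from evaluating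
  symbolically below an abstraction, which takes exponential time.
\<close>

fun step :: "state \<Rightarrow> state" where
  "step (as, us, ps, qs) =
     (push_add as, push_add us, push_max (hd us) ps, push_max (- hd us) qs)"

primrec run :: "nat \<Rightarrow> state \<Rightarrow> state" where
  "run 0 s = s"
| "run (Suc n) s = run n (step s)"

text \<open>Each summand bounds a scaled real weight: \<open>hd as\<close> allows for the truncation
  of \<alpha> in the integer weight \<open>hd us\<close>.\<close>

primrec err_sum :: "nat \<Rightarrow> int \<Rightarrow> int list \<Rightarrow> int list \<Rightarrow> int" where
  "err_sum 0 r as us = r"
| "err_sum (Suc n) r as us = err_sum n (r + hd as + \<bar>hd us\<bar>) (push_add as) (push_add us)"

text \<open>The state at index \<open>1\<close>: the weights satisfy their recursion only from there on.\<close>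

definition init :: "nat \<Rightarrow> int \<Rightarrow> int \<Rightarrow> state" where
  "init g c p = (2 # replicate g 1, (c - 2 * p) # replicate g (c - p),
     max 0 (c - p) # replicate g 0, max 0 (p - c) # replicate g 0)"

text \<open>\<open>up\<close> and \<open>dn\<close> are scaled bounds for the supremum and the
  negated infimum. \<open>hd as\<close> allows for rounding, twice \<open>err_sum\<close> for all
  later indices.\<close>

fun verdict :: "nat \<Rightarrow> int \<Rightarrow> int \<Rightarrow> int \<Rightarrow> state \<Rightarrow> bool" where
  "verdict m up dn eps (as, us, ps, qs) \<longleftrightarrow>
     hd ps + hd as + 2 * err_sum m 0 as us \<le> up \<and> up - eps \<le> hd ps - hd as \<and>
     hd qs + hd as + 2 * err_sum m 0 as us \<le> dn \<and> dn - eps \<le> hd qs - hd as"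

definition certify :: "nat \<Rightarrow> int \<Rightarrow> int \<Rightarrow> nat \<Rightarrow> nat \<Rightarrow> int \<Rightarrow> int \<Rightarrow> int \<Rightarrow> bool" where
  "certify g c p n m up dn eps \<longleftrightarrow> verdict m up dn eps (run n (init g c p))"

section \<open>Correctness of the computation\<close>

text \<open>The value of \<open>c * F x - p * x\<close> at \<open>x = A g e\<close>. Over the reals
  \<open>c = 1\<close> and \<open>p\<close> is \<alpha>; over the integers \<open>p\<close>
  truncates \<open>c\<close> times \<alpha>.\<close>

definition weight :: "nat \<Rightarrow> 'a::linordered_idom \<Rightarrow> 'a \<Rightarrow> nat \<Rightarrow> 'a" where
  "weight g c p e = c * of_nat (A g (e - 1)) - p * of_nat (A g e)"

lemma weight_Suc:
  assumes "1 \<le> g" "1 \<le> e"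
  shows "weight g c p (Suc e) = weight g c p e + weight g c p (e - g)"
proof -
  obtain q where q: "e = Suc q"
    using assms by (cases e) auto
  then show ?thesis
    by (simp add: weight_def algebra_simps diff_commute)
qed

lemma weight_eq:
  assumes "1 \<le> g"
  shows "c * of_nat (F (Suc g) (A g e)) - p * of_nat (A g e) = weight g c p e"
  using F_A_add[OF assms, of e 0] by (simp add: F_0 weight_def)

lemma block_additive_F:
  assumes "1 \<le> g"
  shows "block_additive g (\<lambda>x. c * of_nat (F (Suc g) x) - p * of_nat x)"
  unfolding block_additive_def
proof (intro conjI allI impI)
  fix e r
  assume r: "r < A g (e - g)"
  then have "0 < e \<or> r = 0"
    by (cases e) auto
  then have "F (Suc g) (A g e + r) = A g (e - 1) + F (Suc g) r"
    using F_A_add[OF assms] r by simp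
  moreover have "F (Suc g) (A g e) = A g (e - 1)"
    using F_A_add[OF assms, of e 0] by (simp add: F_0)
  ultimately show "c * of_nat (F (Suc g) (A g e + r)) - p * of_nat (A g e + r) =
      c * of_nat (F (Suc g) (A g e)) - p * of_nat (A g e) + (c * of_nat (F (Suc g) r) - p * of_nat r)"
    by (simp add: algebra_simps)
qed (simp add: F_0)

lemma weight_scale: "weight g (s * c) (s * p) e = s * weight g c p e"
  by (simp add: weight_def algebra_simps)

text \<open>The factor \<open>s\<close> will be 1 or -1, so that maxima and minima are treated at
  once.\<close>

lemma top_sum_F_upper:
  fixes c p :: "'a::linordered_idom"
  assumes "1 \<le> g" "x < A g e"
  shows "s * (c * of_nat (F (Suc g) x) - p * of_nat x) \<le> top_sum g (\<lambda>i. s * weight g c p i) e"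
  using top_sum_upper[OF block_additive_F[OF assms(1), of "s * c" "s * p"] assms(2)]
  by (simp add: weight_eq[OF assms(1)] weight_scale) (simp add: algebra_simps)

lemma top_sum_F_attained:
  fixes c p :: "'a::linordered_idom"
  assumes "1 \<le> g"
  shows "\<exists>x < A g e. s * (c * of_nat (F (Suc g) x) - p * of_nat x) =
    top_sum g (\<lambda>i. s * weight g c p i) e"
  using top_sum_attained[OF block_additive_F[OF assms, of "s * c" "s * p"], of e]
  by (simp add: weight_eq[OF assms] weight_scale) (simp add: algebra_simps)

lemma delta_near:
  fixes c p :: int
  assumes "of_int p \<le> of_int c * alpha k" "of_int c * alpha k \<le> of_int p + 1"
  shows "\<bar>of_int c * delta k x - of_int (c * int (F k x) - p * int x)\<bar> \<le> real x"
proof -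
  have "of_int c * delta k x - of_int (c * int (F k x) - p * int x) =
      - ((of_int c * alpha k - of_int p) * real x)"
    by (simp add: delta_def algebra_simps)
  moreover have "(of_int c * alpha k - of_int p) * real x \<le> 1 * real x"
    using assms by (intro mult_right_mono) auto
  moreover have "0 \<le> (of_int c * alpha k - of_int p) * real x"
    using assms by simp
  ultimately show ?thesis
    by linarith
qed

lemma delta_A:
  assumes "1 \<le> g"
  shows "delta (Suc g) (A g e) = weight g 1 (alpha (Suc g)) e"
  using weight_eq[OF assms, of 1 e "alpha (Suc g)"] by (simp add: delta_def)

text \<open>The hypothesis of \<open>contraction_sum_le\<close> for these discrepancies. Three
  earlier terms suffice, since eliminating the dominant root leaves order \<open>k - 1\<close>,
  which is 2 or 3 for \<open>k = 3, 4\<close>.\<close>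

definition contracting :: "nat \<Rightarrow> nat \<Rightarrow> bool" where
  "contracting g m \<longleftrightarrow> 2 \<le> m \<and>
    (\<exists>a b c. 0 \<le> a \<and> 0 \<le> b \<and> 0 \<le> c \<and> a + b + c \<le> 1 / 2 \<and>
      (\<forall>e. \<bar>delta (Suc g) (A g (e + m))\<bar> \<le> a * \<bar>delta (Suc g) (A g e)\<bar> +
        b * \<bar>delta (Suc g) (A g (e + 1))\<bar> + c * \<bar>delta (Suc g) (A g (e + 2))\<bar>))"

text \<open>The real optimum below \<open>A g N\<close> is attained at a single \<open>y\<close>, so
  replacing \<alpha> by \<open>p / c\<close> costs at most \<open>A g N\<close> in total rather than
  an error per selected index. Later indices enter through the doubled block.\<close>

lemma delta_upper:
  fixes c p s :: int
  assumes g: "1 \<le> g" and c: "0 < c" and s: "\<bar>s\<bar> = 1"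
    and p: "of_int p \<le> of_int c * alpha (Suc g)" "of_int c * alpha (Suc g) \<le> of_int p + 1"
    and m: "contracting g m"
  shows "of_int c * (of_int s * delta (Suc g) x) \<le>
    of_int (top_sum g (\<lambda>i. s * weight g c p i) N + int (A g N) +
      2 * (\<Sum>i<m. int (A g (N + i)) + \<bar>weight g c p (N + i)\<bar>))"
proof -
  define v where "v e = weight g (1::real) (alpha (Suc g)) e" for e
  have delta: "delta (Suc g) y = 1 * real (F (Suc g) y) - alpha (Suc g) * real y" for y
    by (simp add: delta_def)
  have abs_s: "\<bar>real_of_int s\<bar> = 1"
    using s by linarith
  \<comment> \<open>The index \<open>N + x\<close> is large enough for \<open>x\<close> and has the
    form required by \<open>top_sum_tail\<close>.\<close>
  have "x < A g x"
    by (rule A_gt)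
  also have "A g x \<le> A g (N + x)"
    by (rule monoD[OF mono_A]) simp
  finally have "of_int s * delta (Suc g) x \<le> top_sum g (\<lambda>i. of_int s * v i) (N + x)"
    unfolding delta v_def by (rule top_sum_F_upper[OF g])
  also have "\<dots> \<le> top_sum g (\<lambda>i. of_int s * v i) N + (\<Sum>i<x. \<bar>of_int s * v (N + i)\<bar>)"
    by (rule top_sum_tail)
  also have "(\<Sum>i<x. \<bar>of_int s * v (N + i)\<bar>) = (\<Sum>i<x. \<bar>v (N + i)\<bar>)"
    using abs_s by (simp add: abs_mult)
  also have "\<dots> \<le> 2 * (\<Sum>i<m. \<bar>v (N + i)\<bar>)"
  proof -
    obtain a b c' where abc: "0 \<le> a" "0 \<le> b" "0 \<le> c'" "a + b + c' \<le> 1 / 2"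
      and le: "\<And>e. \<bar>v (e + m)\<bar> \<le> a * \<bar>v e\<bar> + b * \<bar>v (e + 1)\<bar> + c' * \<bar>v (e + 2)\<bar>"
      using m unfolding contracting_def delta_A[OF g] v_def by blast
    show ?thesis
      by (rule contraction_sum_le[OF _ _ abc])
        (use le[of "N + _"] m in \<open>auto simp: contracting_def add.assoc\<close>)
  qed
  finally have 1: "of_int s * delta (Suc g) x \<le>
      top_sum g (\<lambda>i. of_int s * v i) N + 2 * (\<Sum>i<m. \<bar>v (N + i)\<bar>)"
    by simp
  obtain y where y: "y < A g N" "of_int s * delta (Suc g) y = top_sum g (\<lambda>i. of_int s * v i) N"
    using top_sum_F_attained[OF g, of N "of_int s" 1 "alpha (Suc g)"] unfolding delta v_def by auto
  note near = delta_near[OF p]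
  have 2: "of_int c * (of_int s * delta (Suc g) y) \<le>
      of_int (top_sum g (\<lambda>i. s * weight g c p i) N + int (A g N))"
  proof -
    let ?L = "c * int (F (Suc g) y) - p * int y"
    have "s * ?L \<le> top_sum g (\<lambda>i. s * weight g c p i) N"
      using top_sum_F_upper[OF g y(1), of s c p] by simp
    then have "of_int s * of_int ?L \<le> real_of_int (top_sum g (\<lambda>i. s * weight g c p i) N)"
      by (metis of_int_le_iff of_int_mult)
    moreover have "of_int c * (of_int s * delta (Suc g) y) - of_int s * of_int ?L \<le>
        \<bar>of_int s * (of_int c * delta (Suc g) y - of_int ?L)\<bar>"
      by (rule order_trans[OF eq_refl abs_ge_self]) (simp add: algebra_simps)
    moreover have "\<dots> \<le> real y"
      using near[of y] abs_s by (simp only: abs_mult mult_1)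
    moreover have "real y \<le> real (A g N)"
      using y by simp
    ultimately show ?thesis
      by simp
  qed
  have 3: "of_int c * \<bar>v e\<bar> \<le> of_int (int (A g e) + \<bar>weight g c p e\<bar>)" for e
  proof -
    have "of_int c * \<bar>v e\<bar> = \<bar>of_int c * v e\<bar>"
      using c by (simp add: abs_mult)
    moreover have "\<bar>of_int c * v e - of_int (weight g c p e)\<bar> \<le> real (A g e)"
      using near[of "A g e"] weight_eq[OF g, of c e p] delta_A[OF g, of e] by (simp add: v_def)
    ultimately show ?thesis
      by simp
  qed
  have "of_int c * (of_int s * delta (Suc g) x) \<le>
      of_int c * (of_int s * delta (Suc g) y) + 2 * (\<Sum>i<m. of_int c * \<bar>v (N + i)\<bar>)"
    using mult_left_mono[OF 1, of "of_int c"] c y(2)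
    by (simp add: algebra_simps sum_distrib_left)
  also have "\<dots> \<le> of_int (top_sum g (\<lambda>i. s * weight g c p i) N + int (A g N)) +
      2 * (\<Sum>i<m. of_int (int (A g (N + i)) + \<bar>weight g c p (N + i)\<bar>))"
    by (intro add_mono mult_left_mono sum_mono 2 3) simp
  finally show ?thesis
    by simp
qed

text \<open>The argument attaining the integer optimum serves as witness; rounding costs less than
  \<open>A g N\<close> there.\<close>

lemma delta_lower:
  fixes c p s :: int
  assumes g: "1 \<le> g" and s: "\<bar>s\<bar> = 1"
    and p: "of_int p \<le> of_int c * alpha (Suc g)" "of_int c * alpha (Suc g) \<le> of_int p + 1"
  shows "\<exists>x. of_int (top_sum g (\<lambda>i. s * weight g c p i) N - int (A g N)) \<le>
    of_int c * (of_int s * delta (Suc g) x)"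
proof -
  obtain x where x: "x < A g N"
    "s * (c * int (F (Suc g) x) - p * int x) = top_sum g (\<lambda>i. s * weight g c p i) N"
    using top_sum_F_attained[OF g, of N s c p] by auto
  let ?L = "c * int (F (Suc g) x) - p * int x"
  have "of_int (s * ?L) - of_int c * (of_int s * delta (Suc g) x) \<le>
      \<bar>of_int s * (of_int c * delta (Suc g) x - of_int ?L)\<bar>"
    by (rule order_trans[OF eq_refl abs_ge_minus_self]) (simp add: algebra_simps)
  also have "\<dots> = \<bar>of_int c * delta (Suc g) x - of_int ?L\<bar>"
    using s by (simp add: abs_mult flip: of_int_abs)
  also have "\<dots> \<le> real x"
    by (rule delta_near[OF p])
  also have "\<dots> \<le> real (A g N)"
    using x by simp
  finally show ?thesis
    unfolding x(2) by (intro exI[of _ x]) simp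
qed

section \<open>Soundness of the list computation\<close>

lemma push_add_hist:
  assumes "f (Suc e) = f e + f (e - g)"
  shows "push_add (hist g f e) = hist g f (Suc e)"
  using hist_Suc[of f e g] assms by (simp add: push_add_def hd_hist last_hist)

lemma push_max_hist: "push_max (w e) (hist g (top_sum g w) e) = hist g (top_sum g w) (Suc e)"
  using hist_Suc[of "top_sum g w" e g] by (simp add: push_max_def hd_hist last_hist)

lemma err_sum_hist:
  assumes "1 \<le> g" "1 \<le> e"
  shows "err_sum m r (hist g (\<lambda>i. int (A g i)) e) (hist g (weight g c p) e) =
    r + (\<Sum>i<m. int (A g (e + i)) + \<bar>weight g c p (e + i)\<bar>)"
  using assms(2)
proof (induction m arbitrary: e r)
  case (Suc m)
  then have "err_sum (Suc m) r (hist g (\<lambda>i. int (A g i)) e) (hist g (weight g c p) e) =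
      r + int (A g e) + \<bar>weight g c p e\<bar> +
      (\<Sum>i<m. int (A g (Suc e + i)) + \<bar>weight g c p (Suc e + i)\<bar>)"
    by (simp add: hd_hist push_add_hist weight_Suc[OF assms(1)])
  then show ?case
    by (simp add: sum.lessThan_Suc_shift del: sum.lessThan_Suc A.simps)
qed simp

definition state_at :: "nat \<Rightarrow> int \<Rightarrow> int \<Rightarrow> nat \<Rightarrow> state" where
  "state_at g c p e = (hist g (\<lambda>i. int (A g i)) e, hist g (weight g c p) e,
     hist g (top_sum g (\<lambda>i. 1 * weight g c p i)) e, hist g (top_sum g (\<lambda>i. - 1 * weight g c p i)) e)"

lemma init_eq: "init g c p = state_at g c p 1"
  unfolding state_at_def hist_1 init_def by (simp add: weight_def)

lemma run_state_at:
  assumes "1 \<le> g" "1 \<le> e"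
  shows "run n (state_at g c p e) = state_at g c p (e + n)"
  using assms(2)
proof (induction n arbitrary: e)
  case (Suc n)
  have "step (state_at g c p e) = state_at g c p (Suc e)"
    using push_max_hist[of "\<lambda>i. - weight g c p i" e g] Suc.prems
    by (simp add: state_at_def push_add_hist push_max_hist hd_hist weight_Suc[OF assms(1)])
  then show ?case
    using Suc.IH[of "Suc e"] by simp
qed simp

lemma certify_bounds:
  fixes c p :: int
  assumes g: "1 \<le> g" and c: "0 < c"
    and p: "of_int p \<le> of_int c * alpha (Suc g)" "of_int c * alpha (Suc g) \<le> of_int p + 1"
    and m: "contracting g m" and cert: "certify g c p n m up dn eps"
  shows "of_int c * delta (Suc g) x \<le> of_int up" "- of_int dn \<le> of_int c * delta (Suc g) x"
    "\<exists>x. of_int (up - eps) \<le> of_int c * delta (Suc g) x"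
    "\<exists>x. of_int c * delta (Suc g) x \<le> of_int (eps - dn)"
proof -
  \<comment> \<open>The run starts at index 1. Below, sign \<open>1\<close> gives the bounds for the
    supremum and sign \<open>- 1\<close> those for the infimum.\<close>
  define N where "N = Suc n"
  define t where "t s = top_sum g (\<lambda>i. s * weight g c p i) N" for s
  define a where "a = int (A g N)"
  define err where "err = a + 2 * (\<Sum>i<m. int (A g (N + i)) + \<bar>weight g c p (N + i)\<bar>)"
  have "run n (init g c p) = state_at g c p N"
    using run_state_at[OF g, of 1 n c p] by (simp add: init_eq N_def)
  moreover have "1 \<le> N"
    by (simp add: N_def)
  ultimately have *: "t 1 + err \<le> up" "up - eps \<le> t 1 - a" "t (- 1) + err \<le> dn" "dn - eps \<le> t (- 1) - a"
    using cert unfolding certify_def state_at_def t_def err_def a_def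
    by (simp_all add: add.assoc hd_hist err_sum_hist[OF g])
  have upper: "of_int c * (of_int s * delta (Suc g) x) \<le> of_int (t s + err)" if "\<bar>s\<bar> = 1" for s
    using delta_upper[OF g c that p m, of x N] by (simp add: t_def err_def a_def)
  have lower: "\<exists>x. of_int (t s - a) \<le> of_int c * (of_int s * delta (Suc g) x)" if "\<bar>s\<bar> = 1" for s
    using delta_lower[OF g that p, of N] by (simp add: t_def a_def)
  have "real_of_int (t 1 + err) \<le> of_int up" "real_of_int (t (- 1) + err) \<le> of_int dn"
    using * by (simp_all only: of_int_le_iff)
  then show "of_int c * delta (Suc g) x \<le> of_int up" "- of_int dn \<le> of_int c * delta (Suc g) x"
    using upper[of 1] upper[of "- 1"] by simp_all
  have **: "real_of_int (up - eps) \<le> of_int (t 1 - a)" "real_of_int (dn - eps) \<le> of_int (t (- 1) - a)"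
    using * by (simp_all only: of_int_le_iff)
  show "\<exists>x. of_int (up - eps) \<le> of_int c * delta (Suc g) x"
    using lower[of 1] order_trans[OF **(1)] by auto
  obtain y where "of_int (t (- 1) - a) \<le> of_int c * (of_int (- 1) * delta (Suc g) y)"
    using lower[of "- 1"] by auto
  then show "\<exists>x. of_int c * delta (Suc g) x \<le> of_int (eps - dn)"
    using **(2) by (intro exI[of _ y]) simp
qed

section \<open>Decay of the weights for \<open>k = 3, 4\<close>\<close>

lemma alpha_root:
  assumes "1 \<le> k"
  shows "0 < alpha k" "alpha k ^ k + alpha k = 1"
  using theI'[OF alpha_ex1[OF assms]] by (simp_all add: alpha_def)

lemma alpha_ge:
  assumes "1 \<le> k" "q ^ k + q \<le> 1"
  shows "q \<le> alpha k"
proof (rule ccontr)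
  assume "\<not> q \<le> alpha k"
  then have "alpha k ^ k + alpha k < q ^ k + q"
    using alpha_root(1)[OF assms(1)] by (intro add_le_less_mono power_mono) auto
  then show False
    using alpha_root(2)[OF assms(1)] assms(2) by simp
qed

lemma alpha_le:
  assumes "1 \<le> k" "0 \<le> q" "1 \<le> q ^ k + q"
  shows "alpha k \<le> q"
proof (rule ccontr)
  assume "\<not> alpha k \<le> q"
  then have "q ^ k + q < alpha k ^ k + alpha k"
    using assms(2) by (intro add_le_less_mono power_mono) auto
  then show False
    using alpha_root(2)[OF assms(1)] assms(3) by simp
qed

lemma abs_linear_combination_le:
  fixes a b c :: real
  shows "\<bar>a * x + b * y + c * z\<bar> \<le> \<bar>a\<bar> * \<bar>x\<bar> + \<bar>b\<bar> * \<bar>y\<bar> + \<bar>c\<bar> * \<bar>z\<bar>"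
  by (simp add: abs_mult[symmetric])

lemma contractingI:
  assumes "2 \<le> m" "\<bar>a\<bar> + \<bar>b\<bar> + \<bar>c\<bar> \<le> 1 / 2"
    and "\<And>e. delta (Suc g) (A g (e + m)) =
      a * delta (Suc g) (A g e) + b * delta (Suc g) (A g (e + 1)) + c * delta (Suc g) (A g (e + 2))"
  shows "contracting g m"
  unfolding contracting_def
  by (intro conjI exI[of _ "\<bar>a\<bar>"] exI[of _ "\<bar>b\<bar>"] exI[of _ "\<bar>c\<bar>"] allI)
    (simp_all only: assms abs_linear_combination_le abs_ge_zero)

text \<open>The reduced recursion has characteristic polynomial \<open>X^2 + x^2 X + x\<close>,
  whose complex roots have modulus \<open>sqrt x < 1\<close>; after five steps the coefficients sum
  to about 0.43.\<close>

lemma contracting_3: "contracting 2 5"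
proof -
  define x where "x = alpha (Suc 2)"
  define v where "v e = weight 2 1 x e" for e
  have x: "x ^ 3 + x = 1"
    using alpha_root(2)[of "Suc 2"] by (simp add: x_def eval_nat_numeral)
  have x_bounds: "0.68 \<le> x" "x \<le> 0.69"
    unfolding x_def by (rule alpha_ge alpha_le; simp add: power3_eq_cube)+
  have v_Suc: "v (Suc e) = v e + v (e - 2)" if "1 \<le> e" for e
    unfolding v_def using that by (intro weight_Suc) auto
  have delta_v: "delta (Suc 2) (A 2 e) = v e" for e
    unfolding v_def x_def by (rule delta_A) simp
  \<comment> \<open>The factor \<open>X - 1/x\<close> of \<open>X\<^sup>3 - X\<^sup>2 - 1\<close> is not needed to annihilate \<open>v\<close>.\<close>
  have v_rel: "v (e + 2) = - (x ^ 2) * v (e + 1) - x * v e" for e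
  proof (induction e)
    case 0
    \<comment> \<open>The initial values satisfy the reduced recursion, that is, they have no
      component along the root \<open>1/x\<close>.\<close>
    have "v 0 = 1 - x" "v 1 = 1 - 2 * x" "v 2 = 2 - 3 * x"
      by (simp_all add: v_def weight_def A_small)
    then have "v 2 = - (x ^ 2) * v 1 - x * v 0"
      using x by algebra
    then show ?case
      by (simp add: numeral_2_eq_2)
  next
    case (Suc e)
    have "v (Suc e + 2) = v (e + 2) + v e"
      using v_Suc[of "e + 2"] by simp
    \<comment> \<open>As \<open>x * (1 + x ^ 2) = 1\<close>, the goal times \<open>x\<close> is the
      induction hypothesis.\<close>
    then have "v (Suc e + 2) = - (x ^ 2) * v (e + 2) - x * v (e + 1)"
      using Suc x by algebra
    then show ?case
      by simp
  qed
  \<comment> \<open>The full recursion reaches back to three consecutive values, and the reduced one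
    removes \<open>v (e + 2)\<close>; its zero coefficient pads to three terms.\<close>
  have step: "v (e + 5) = (1 - 2 * x) * v e + (1 - 2 * x ^ 2) * v (e + 1) + 0 * v (e + 2)" for e
  proof -
    have "v (e + 5) = v e + v (e + 1) + 2 * v (e + 2)"
      using v_Suc[of "e + 2"] v_Suc[of "e + 3"] v_Suc[of "e + 4"] by (simp add: eval_nat_numeral)
    then show ?thesis
      unfolding v_rel by (simp add: algebra_simps)
  qed
  have le: "\<bar>1 - 2 * x\<bar> + \<bar>1 - 2 * x ^ 2\<bar> + \<bar>0\<bar> \<le> 1 / 2"
  proof -
    have "0.68 ^ 2 \<le> x ^ 2" "x ^ 2 \<le> 0.69 ^ 2"
      using x_bounds by (auto intro!: power_mono)
    then show ?thesis
      using x_bounds by (simp add: power2_eq_square abs_le_iff)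
  qed
  show ?thesis
    by (rule contractingI[OF _ le]) (unfold delta_v, simp, rule step)
qed

text \<open>Dividing \<open>X^4 - X^3 - 1\<close> by \<open>X - 1/x\<close> leaves
  \<open>X^3 + x^3 X^2 + x^2 X + x\<close>. Its largest roots have modulus about 0.94, hence as many
  as 14 steps.\<close>

lemma contracting_4: "contracting 3 14"
proof -
  define x where "x = alpha (Suc 3)"
  define v where "v e = weight 3 1 x e" for e
  have x: "x ^ 4 + x = 1"
    using alpha_root(2)[of "Suc 3"] by (simp add: x_def eval_nat_numeral)
  \<comment> \<open>The coefficient sum is about 0.49, so only a narrow interval keeps it below
    1/2.\<close>
  have x_bounds: "0.7244 \<le> x" "x \<le> 0.7245"
    unfolding x_def by (rule alpha_ge alpha_le; simp add: power4_eq_xxxx)+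
  have v_Suc: "v (Suc e) = v e + v (e - 3)" if "1 \<le> e" for e
    unfolding v_def using that by (intro weight_Suc) auto
  have delta_v: "delta (Suc 3) (A 3 e) = v e" for e
    unfolding v_def x_def by (rule delta_A) simp
  have v_rel: "v (e + 3) = - (x ^ 3) * v (e + 2) - x ^ 2 * v (e + 1) - x * v e" for e
  proof (induction e)
    case 0
    have "v 0 = 1 - x" "v 1 = 1 - 2 * x" "v 2 = 2 - 3 * x" "v 3 = 3 - 4 * x"
      by (simp_all add: v_def weight_def A_small)
    then have "v 3 = - (x ^ 3) * v 2 - x ^ 2 * v 1 - x * v 0"
      using x by algebra
    then show ?case
      by (simp add: numeral_2_eq_2)
  next
    case (Suc e)
    have "v (Suc e + 3) = v (e + 3) + v e"
      using v_Suc[of "e + 3"] by simp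
    then have "v (Suc e + 3) = - (x ^ 3) * v (e + 3) - x ^ 2 * v (e + 2) - x * v (e + 1)"
      using Suc x by algebra
    then show ?case
      by (simp add: numeral_3_eq_3 numeral_2_eq_2)
  qed
  have step: "v (e + 14) = (14 - 19 * x) * v e + (10 - 19 * x ^ 2) * v (e + 1) +
      (7 - 19 * x ^ 3) * v (e + 2)" for e
  proof -
    have "v (e + 14) = 14 * v e + 10 * v (e + 1) + 7 * v (e + 2) + 19 * v (e + 3)"
      using v_Suc[of "e + 3"] v_Suc[of "e + 4"] v_Suc[of "e + 5"] v_Suc[of "e + 6"]
        v_Suc[of "e + 7"] v_Suc[of "e + 8"] v_Suc[of "e + 9"] v_Suc[of "e + 10"]
        v_Suc[of "e + 11"] v_Suc[of "e + 12"] v_Suc[of "e + 13"]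
      by (simp add: eval_nat_numeral)
    then show ?thesis
      unfolding v_rel by (simp add: algebra_simps)
  qed
  have le: "\<bar>14 - 19 * x\<bar> + \<bar>10 - 19 * x ^ 2\<bar> + \<bar>7 - 19 * x ^ 3\<bar> \<le> 1 / 2"
  proof -
    have "0.7244 ^ 2 \<le> x ^ 2" "x ^ 2 \<le> 0.7245 ^ 2" "0.7244 ^ 3 \<le> x ^ 3" "x ^ 3 \<le> 0.7245 ^ 3"
      using x_bounds by (auto intro!: power_mono)
    then show ?thesis
      using x_bounds by (simp add: power2_eq_square power3_eq_cube abs_if)
  qed
  show ?thesis
    by (rule contractingI[OF _ le]) (unfold delta_v, simp, rule step)
qed

section \<open>The numerical bounds\<close>

text \<open>Negative values do not affect the absolute supremum: their size is at most
  \<open>- lo \<le> hi - e\<close>, which some value of \<open>delta k\<close> reaches.\<close>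

lemma sup_inf_delta_bounds:
  assumes lo: "\<And>x. lo \<le> delta k x" and hi: "\<And>x. delta k x \<le> hi"
    and lo': "\<exists>x. delta k x \<le> lo + e" and hi': "\<exists>x. hi - e \<le> delta k x"
    and le: "- lo \<le> hi - e"
  shows "ereal (hi - e) \<le> sup_delta k" "sup_delta k \<le> ereal hi"
    "ereal lo \<le> inf_delta k" "inf_delta k \<le> ereal (lo + e)" "sup_abs_delta k = sup_delta k"
proof -
  show "ereal (hi - e) \<le> sup_delta k"
    using hi' unfolding sup_delta_def by (auto intro: SUP_upper2)
  show "inf_delta k \<le> ereal (lo + e)"
    using lo' unfolding inf_delta_def by (auto intro: INF_lower2)
  show "sup_delta k \<le> ereal hi"
    using hi unfolding sup_delta_def by (auto intro: SUP_least)
  show "ereal lo \<le> inf_delta k"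
    using lo unfolding inf_delta_def by (auto intro: INF_greatest)
  show "sup_abs_delta k = sup_delta k"
  proof (rule antisym)
    show "sup_abs_delta k \<le> sup_delta k"
      unfolding sup_abs_delta_def
    proof (rule SUP_least)
      fix x
      have "ereal (delta k x) \<le> sup_delta k"
        unfolding sup_delta_def by (rule SUP_upper) simp
      moreover have "ereal (- delta k x) \<le> ereal (hi - e)"
        using lo[of x] le by simp
      then have "ereal (- delta k x) \<le> sup_delta k"
        using \<open>ereal (hi - e) \<le> sup_delta k\<close> by (rule order_trans)
      ultimately show "ereal \<bar>delta k x\<bar> \<le> sup_delta k"
        by (simp add: abs_if)
    qed
    show "sup_delta k \<le> sup_abs_delta k"
      unfolding sup_abs_delta_def sup_delta_def by (intro SUP_mono') simp
  qed
qed

text \<open>Clearing the denominator \<open>c ^ k\<close> turns the location of the root between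
  \<open>p / c\<close> and \<open>(p + 1) / c\<close> into integer inequalities.\<close>

lemma alpha_decimals:
  fixes p c :: int
  assumes "1 \<le> k" "0 < c" "0 \<le> p" "p ^ k + p * c ^ (k - 1) \<le> c ^ k"
    "c ^ k \<le> (p + 1) ^ k + (p + 1) * c ^ (k - 1)"
  shows "of_int p \<le> of_int c * alpha k" "of_int c * alpha k \<le> of_int p + 1"
proof -
  have *: "(of_int q / of_int c) ^ k + of_int q / of_int c =
      (of_int (q ^ k + q * c ^ (k - 1)) / of_int (c ^ k) :: real)" for q
    using assms(1,2) by (cases k) (auto simp: field_simps)
  have "(of_int p / of_int c) ^ k + of_int p / of_int c \<le> (1::real)"
    unfolding * using assms(2,4) by (simp add: divide_le_eq_1 del: of_int_add of_int_mult of_int_power)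
  then have "of_int p / of_int c \<le> alpha k"
    by (rule alpha_ge[OF assms(1)])
  then show "of_int p \<le> of_int c * alpha k"
    using assms(2) by (simp add: field_simps)
  have "(1::real) \<le> (of_int (p + 1) / of_int c) ^ k + of_int (p + 1) / of_int c"
    unfolding * using assms(2,5) by (simp add: le_divide_eq_1 del: of_int_add of_int_mult of_int_power)
  then have "alpha k \<le> of_int (p + 1) / of_int c"
    using assms(2,3) by (intro alpha_le[OF assms(1)]) auto
  then show "of_int c * alpha k \<le> of_int p + 1"
    using assms(2) by (simp add: field_simps)
qed

section \<open>Decimals of the roots and numerical certificates\<close>

definition alpha3_digits :: int where
  "alpha3_digits = 68232780382801932736948373971104825689118858189799857780372860663989667868699802108173204378620512829559331876"

definition alpha4_digits :: int where
  "alpha4_digits = 72449195900051561158837228218703656578649448135001101727039802843745290647512436791758328114544001931488460697"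

text \<open>Together the checks force twice the tail block plus twice the rounding allowance to be
  at most \<open>3 * 10 ^ 77\<close>; index 410 is large enough for this.\<close>

lemma certify_3:
  "certify 2 (10 ^ 110) alpha3_digits 409 5 (854187179928304211983581540152668 * 10 ^ 77)
    (708415898743967960305146324178773 * 10 ^ 77) (3 * 10 ^ 77)"
  by code_simp

text \<open>Slower decay requires index 640, where \<open>A\<close> is near \<open>10 ^ 90\<close>;
  the scale \<open>10 ^ 110\<close> keeps this rounding small against
  \<open>6 * 10 ^ 94\<close>.\<close>

lemma certify_4:
  "certify 3 (10 ^ 110) alpha4_digits 639 14 (15834687793247475 * 10 ^ 94)
    (15060895457389591 * 10 ^ 94) (6 * 10 ^ 94)"
  by code_simp

lemma alpha3_decimals:
  "of_int alpha3_digits \<le> of_int (10 ^ 110) * alpha (Suc 2)"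
  "of_int (10 ^ 110) * alpha (Suc 2) \<le> of_int alpha3_digits + 1"
proof -
  have *: "0 \<le> alpha3_digits"
    "alpha3_digits ^ Suc 2 + alpha3_digits * (10 ^ 110) ^ (Suc 2 - 1) \<le> (10 ^ 110) ^ Suc 2"
    "(10 ^ 110) ^ Suc 2 \<le> (alpha3_digits + 1) ^ Suc 2 + (alpha3_digits + 1) * (10 ^ 110) ^ (Suc 2 - 1)"
    by code_simp+
  show "of_int alpha3_digits \<le> of_int (10 ^ 110) * alpha (Suc 2)"
    "of_int (10 ^ 110) * alpha (Suc 2) \<le> of_int alpha3_digits + 1"
    by (rule alpha_decimals[OF _ _ *]; simp)+
qed

lemma alpha4_decimals:
  "of_int alpha4_digits \<le> of_int (10 ^ 110) * alpha (Suc 3)"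
  "of_int (10 ^ 110) * alpha (Suc 3) \<le> of_int alpha4_digits + 1"
proof -
  have *: "0 \<le> alpha4_digits"
    "alpha4_digits ^ Suc 3 + alpha4_digits * (10 ^ 110) ^ (Suc 3 - 1) \<le> (10 ^ 110) ^ Suc 3"
    "(10 ^ 110) ^ Suc 3 \<le> (alpha4_digits + 1) ^ Suc 3 + (alpha4_digits + 1) * (10 ^ 110) ^ (Suc 3 - 1)"
    by code_simp+
  show "of_int alpha4_digits \<le> of_int (10 ^ 110) * alpha (Suc 3)"
    "of_int (10 ^ 110) * alpha (Suc 3) \<le> of_int alpha4_digits + 1"
    by (rule alpha_decimals[OF _ _ *]; simp)+
qed

lemma delta_3_bounds:
  "ereal (d3_plus - 3 / 10 ^ 33) \<le> sup_delta 3" "sup_delta 3 \<le> ereal d3_plus"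
  "ereal d3_minus \<le> inf_delta 3" "inf_delta 3 \<le> ereal (d3_minus + 3 / 10 ^ 33)"
  "sup_abs_delta 3 = sup_delta 3"
proof -
  have 3: "Suc 2 = 3"
    by simp
  note b = certify_bounds[OF _ _ alpha3_decimals contracting_3 certify_3, unfolded 3]
  have hi: "delta 3 x \<le> d3_plus" for x
    using b(1)[of x] by (simp add: d3_plus_def)
  have lo: "d3_minus \<le> delta 3 x" for x
    using b(2)[of x] by (simp add: d3_minus_def)
  have hi': "\<exists>x. d3_plus - 3 / 10 ^ 33 \<le> delta 3 x"
    using b(3) by (auto simp: d3_plus_def mult.commute)
  have lo': "\<exists>x. delta 3 x \<le> d3_minus + 3 / 10 ^ 33"
    using b(4) by (simp add: d3_minus_def field_simps)
  have le: "- d3_minus \<le> d3_plus - 3 / 10 ^ 33"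
    by (simp add: d3_plus_def d3_minus_def)
  show "ereal (d3_plus - 3 / 10 ^ 33) \<le> sup_delta 3" "sup_delta 3 \<le> ereal d3_plus"
    "ereal d3_minus \<le> inf_delta 3" "inf_delta 3 \<le> ereal (d3_minus + 3 / 10 ^ 33)"
    "sup_abs_delta 3 = sup_delta 3"
    by (rule sup_inf_delta_bounds[OF lo hi lo' hi' le])+
qed

lemma delta_4_bounds:
  "ereal (d4_plus - 6 / 10 ^ 16) \<le> sup_delta 4" "sup_delta 4 \<le> ereal d4_plus"
  "ereal d4_minus \<le> inf_delta 4" "inf_delta 4 \<le> ereal (d4_minus + 6 / 10 ^ 16)"
  "sup_abs_delta 4 = sup_delta 4"
proof -
  have 4: "Suc 3 = 4"
    by simp
  note b = certify_bounds[OF _ _ alpha4_decimals contracting_4 certify_4, unfolded 4]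
  have hi: "delta 4 x \<le> d4_plus" for x
    using b(1)[of x] by (simp add: d4_plus_def)
  have lo: "d4_minus \<le> delta 4 x" for x
    using b(2)[of x] by (simp add: d4_minus_def)
  have hi': "\<exists>x. d4_plus - 6 / 10 ^ 16 \<le> delta 4 x"
    using b(3) by (auto simp: d4_plus_def mult.commute)
  have lo': "\<exists>x. delta 4 x \<le> d4_minus + 6 / 10 ^ 16"
    using b(4) by (simp add: d4_minus_def field_simps)
  have le: "- d4_minus \<le> d4_plus - 6 / 10 ^ 16"
    by (simp add: d4_plus_def d4_minus_def)
  show "ereal (d4_plus - 6 / 10 ^ 16) \<le> sup_delta 4" "sup_delta 4 \<le> ereal d4_plus"
    "ereal d4_minus \<le> inf_delta 4" "inf_delta 4 \<le> ereal (d4_minus + 6 / 10 ^ 16)"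
    "sup_abs_delta 4 = sup_delta 4"
    by (rule sup_inf_delta_bounds[OF lo hi lo' hi' le])+
qed

theorem theorem8p10:
  shows
    "ereal (d3_plus - 3 / 10 ^ 33) \<le> sup_delta 3 \<and> sup_delta 3 \<le> ereal d3_plus \<and>
     ereal d3_minus \<le> inf_delta 3 \<and> inf_delta 3 \<le> ereal (d3_minus + 3 / 10 ^ 33) \<and>
     ereal (d4_plus - 6 / 10 ^ 16) \<le> sup_delta 4 \<and> sup_delta 4 \<le> ereal d4_plus \<and>
     ereal d4_minus \<le> inf_delta 4 \<and> inf_delta 4 \<le> ereal (d4_minus + 6 / 10 ^ 16) \<and>
     sup_abs_delta 3 = sup_delta 3 \<and> sup_abs_delta 4 = sup_delta 4 \<and>
     ereal (d3_plus - 3 / 10 ^ 33) \<le> sup_abs_delta 3 \<and> sup_abs_delta 3 \<le> ereal d3_plus \<and>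
     ereal (d4_plus - 6 / 10 ^ 16) \<le> sup_abs_delta 4 \<and> sup_abs_delta 4 \<le> ereal d4_plus"
  using delta_3_bounds delta_4_bounds by simp

end
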